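(* Let $\mu>0$ be fixed, and for $\lambda>3\left(\frac\mu2\right)^{2/3}$ let $x_1<x_2<x_3$ be the three real roots of $x^3-\lambda x-\mu=0$ and $$\Lambda^{\Theta}=\Lambda^\Theta(\lambda)=-2\sqrt{\mu}\int_{x_1}^{x_2}\frac{dx}{x\sqrt{x^3-\lambda x-\mu}} .$$ Then (1) as $\lambda\to3\left(\frac\mu2\right)^{2/3}$, $\ \Lambda^\Theta\to2\sqrt{2/3}\,\pi$; (2) as $\lambda\to+\infty$, $\ \Lambda^\Theta\to2\pi$. *)

theory Defs
  imports "HOL-Analysis.Analysis" "HOL-Computational_Algebra.Polynomial"
begin

definition cubic :: "real \<Rightarrow> real \<Rightarrow> real \<Rightarrow> real" where
  "cubic \<mu> lam x = x ^ 3 - lam * x - \<mu>"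

definition lambda_crit :: "real \<Rightarrow> real" where
  "lambda_crit \<mu> = 3 * (\<mu> / 2) powr (2/3)"

text \<open>The real roots in increasing order, counted from 1.  For \<open>\<mu> > 0\<close> and
  \<open>lam > lambda_crit \<mu>\<close> there are exactly three of them; see \<open>cubic_three_roots\<close> below.
  Outside this range the value is meaningless if there are fewer than \<open>i\<close> roots.\<close>

definition cubic_root :: "real \<Rightarrow> real \<Rightarrow> nat \<Rightarrow> real" where
  "cubic_root \<mu> lam i = sorted_list_of_set {x. cubic \<mu> lam x = 0} ! (i - 1)"

text \<open>The integrand is unbounded at both end points; the interval Lebesgue integral is taken over
  the open interval, where the integrand is negative (\<open>x < 0\<close> and the cubic is positive), so it
  agrees with the improper Riemann integral.\<close>

definition Lambda_Theta :: "real \<Rightarrow> real \<Rightarrow> real" where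
  "Lambda_Theta \<mu> lam =
     - 2 * sqrt \<mu> *
       (LBINT x = ereal (cubic_root \<mu> lam 1)..ereal (cubic_root \<mu> lam 2).
          1 / (x * sqrt (cubic \<mu> lam x)))"

lemma finite_cubic_roots: "finite {x. cubic \<mu> lam x = 0}"
  and card_cubic_roots_le: "card {x. cubic \<mu> lam x = 0} \<le> 3"
proof -
  have eq: "{x. cubic \<mu> lam x = 0} = {x. poly [:-\<mu>, -lam, 0, 1:] x = 0}"
    by (auto simp: cubic_def algebra_simps power3_eq_cube)
  show "finite {x. cubic \<mu> lam x = 0}"
    unfolding eq by (rule poly_roots_finite) simp
  show "card {x. cubic \<mu> lam x = 0} \<le> 3"
    unfolding eq using card_poly_roots_bound[of "[:-\<mu>, -lam, 0, 1:]"] by simp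
qed

lemma cubic_three_roots:
  assumes "\<mu> > 0" "lam > lambda_crit \<mu>"
  shows "{x. cubic \<mu> lam x = 0} = {cubic_root \<mu> lam 1, cubic_root \<mu> lam 2, cubic_root \<mu> lam 3}"
    and "cubic_root \<mu> lam 1 < cubic_root \<mu> lam 2"
    and "cubic_root \<mu> lam 2 < 0"
    and "0 < cubic_root \<mu> lam 3"
proof -
  define a where "a = (\<mu> / 2) powr (1/3)"
  define s where "s = sqrt (lam / 3)"
  have a: "a > 0" "a ^ 3 = \<mu> / 2" "lambda_crit \<mu> = 3 * a\<^sup>2"
    using assms(1) by (simp_all add: a_def lambda_crit_def powr_power)
  have "lam / 3 > a\<^sup>2"
    using assms(2) a(3) by simp
  then have sa: "s > a"
    unfolding s_def by (rule real_less_rsqrt)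
  have "lam / 3 > 0"
    using \<open>lam / 3 > a\<^sup>2\<close> zero_le_power2[of a] by linarith
  then have lam: "lam = 3 * s\<^sup>2"
    by (simp add: s_def)
  have s3: "2 * s ^ 3 > \<mu>"
    using power_strict_mono[OF sa, of 3] a by simp
  have s0: "s > 0"
    using sa a by simp
  have val: "cubic \<mu> lam (-2 * s) = -2 * s^3 - \<mu>" "cubic \<mu> lam (-s) = 2 * s^3 - \<mu>"
    "cubic \<mu> lam 0 = -\<mu>" "cubic \<mu> lam (2 * s) = 2 * s^3 - \<mu>"
    by (simp_all add: cubic_def lam power2_eq_square power3_eq_cube)
  have cont: "continuous_on S (cubic \<mu> lam)" for S
    unfolding cubic_def by (intro continuous_intros)
  obtain u where u: "-2 * s \<le> u" "u \<le> -s" "cubic \<mu> lam u = 0"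
    using IVT'[of "cubic \<mu> lam" "-2 * s" 0 "-s"] val s3 s0 assms(1) cont by fastforce
  obtain v where v: "-s \<le> v" "v \<le> 0" "cubic \<mu> lam v = 0"
    using IVT2'[of "cubic \<mu> lam" 0 0 "-s"] val s3 s0 assms(1) cont by fastforce
  obtain w where w: "0 \<le> w" "w \<le> 2 * s" "cubic \<mu> lam w = 0"
    using IVT'[of "cubic \<mu> lam" 0 0 "2 * s"] val s3 s0 assms(1) cont by fastforce
  have ne: "u \<noteq> -s" "v \<noteq> 0" "w \<noteq> 0"
    using u v w val s3 assms(1) by auto
  have ord: "u < v" "v < 0" "0 < w"
    using u v w ne by linarith+
  have "{u, v, w} = {x. cubic \<mu> lam x = 0}"
    by (rule card_seteq) (use finite_cubic_roots card_cubic_roots_le[of \<mu> lam] u v w ord in auto)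
  moreover have "sorted_list_of_set {u, v, w} = [u, v, w]"
    using sorted_list_of_set.idem_if_sorted_distinct[of "[u, v, w]"] ord by simp
  ultimately have "cubic_root \<mu> lam 1 = u" "cubic_root \<mu> lam 2 = v" "cubic_root \<mu> lam 3 = w"
    "{x. cubic \<mu> lam x = 0} = {u, v, w}"
    by (simp_all add: cubic_root_def)
  then show "{x. cubic \<mu> lam x = 0} = {cubic_root \<mu> lam 1, cubic_root \<mu> lam 2, cubic_root \<mu> lam 3}"
    and "cubic_root \<mu> lam 1 < cubic_root \<mu> lam 2"
    and "cubic_root \<mu> lam 2 < 0"
    and "0 < cubic_root \<mu> lam 3"
    using ord by simp_all
qed

end

theory Submission
  imports Defs
begin

text \<open>
  Put \<open>a = -x\<^sub>2\<close>, \<open>b = -x\<^sub>1\<close> and \<open>y = x\<^sub>3 = a + b\<close>, so that \<open>\<mu> = a b y\<close>.  The substitution \<open>x = -p\<close>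
  turns \<open>\<Lambda>\<close> into twice the integral of \<open>sqrt (y / (p + y))\<close> against the measure with density
  \<open>sqrt (a b) / (p sqrt ((p - a) (b - p)))\<close> on \<open>(a, b)\<close>, which has total mass \<open>\<pi>\<close> and first
  moment \<open>\<pi> sqrt (a b)\<close>.  At the critical value \<open>a\<close> and \<open>b\<close> coalesce and the factor
  tends uniformly to \<open>sqrt (2/3)\<close>.  At infinity \<open>sqrt (y / (p + y)) \<ge> 1 - p / (2 y)\<close> bounds the
  defect from \<open>2 \<pi>\<close> by \<open>\<pi> sqrt (a b) / y = \<pi> sqrt (\<mu> / y\<^sup>3)\<close>, while \<open>y\<^sup>2 \<ge> \<lambda>\<close>.
\<close>

section \<open>Arcsine integrals with end-point singularities\<close>

text \<open>Since \<open>h\<close> is the positive square root of \<open>1 - g^2\<close>,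
  \<open>arcsin (g x)\<close> is a primitive of \<open>f\<close> inside the interval and is
  continuous up to its ends. For a nonnegative integrand the improper fundamental theorem then
  yields integrability together with the value \<open>pi/2 - (- pi/2)\<close>.\<close>

lemma arcsin_FTC:
  fixes a b :: real and g g' f :: "real \<Rightarrow> real"
  assumes ab: "a < b"
    and g: "\<And>x. a < x \<Longrightarrow> x < b \<Longrightarrow> (g has_real_derivative g' x) (at x)"
    and sq: "\<And>x. a < x \<Longrightarrow> x < b \<Longrightarrow> 1 - (g x)\<^sup>2 = (h x)\<^sup>2"
    and h: "\<And>x. a < x \<Longrightarrow> x < b \<Longrightarrow> h x > 0"
    and f: "\<And>x. a < x \<Longrightarrow> x < b \<Longrightarrow> f x = g' x / h x"
    and f0: "\<And>x. a < x \<Longrightarrow> x < b \<Longrightarrow> f x \<ge> 0"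
    and cf: "\<And>x. a < x \<Longrightarrow> x < b \<Longrightarrow> isCont f x"
    and cg: "continuous_on {a..b} g"
    and ga: "g a = -1" and gb: "g b = 1"
  shows "set_integrable lborel {a<..<b} f" "(LBINT x=a..b. f x) = pi"
proof -
  have g1: "-1 < g x \<and> g x < 1" if "a < x" "x < b" for x
  proof -
    have "(g x)\<^sup>2 < 1\<^sup>2"
      using sq[OF that] h[OF that] by (smt (verit) zero_less_power one_power2)
    then show ?thesis
      using abs_square_less_1[of "g x"] by auto
  qed
  have rng: "g ` {a..b} \<subseteq> {-1..1}"
  proof
    fix z assume "z \<in> g ` {a..b}"
    then obtain x where x: "z = g x" "a \<le> x" "x \<le> b"
      by auto
    consider "x = a" | "x = b" | "a < x" "x < b"
      using x by linarith
    then show "z \<in> {-1..1}"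
      by cases (use x ga gb g1[of x] in auto)
  qed
  have cas: "continuous_on {a..b} (\<lambda>x. arcsin (g x))"
    using rng by (intro continuous_on_arcsin cg) auto
  have der: "((\<lambda>x. arcsin (g x)) has_real_derivative f x) (at x)" if "a < x" "x < b" for x
  proof -
    have "sqrt (1 - (g x)\<^sup>2) = h x"
      using sq[OF that] h[OF that] by simp
    then show ?thesis
      using g1[OF that] h[OF that] f[OF that]
      by (auto intro!: derivative_eq_intros g[OF that] simp: field_simps)
  qed
  have lim: "((\<lambda>x. arcsin (g x)) \<longlongrightarrow> arcsin (g a)) (at_right a)"
    "((\<lambda>x. arcsin (g x)) \<longlongrightarrow> arcsin (g b)) (at_left b)"
    using continuous_on_Icc_at_rightD[OF cas ab] continuous_on_Icc_at_leftD[OF cas ab] by auto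
  have limA: "(((\<lambda>x. arcsin (g x)) \<circ> real_of_ereal) \<longlongrightarrow> - (pi/2)) (at_right (ereal a))"
    and limB: "(((\<lambda>x. arcsin (g x)) \<circ> real_of_ereal) \<longlongrightarrow> pi/2) (at_left (ereal b))"
    using lim by (simp_all add: ga gb arcsin_minus_1 ereal_tendsto_simps1)
  have lt: "ereal a < ereal b"
    using ab by simp
  have nn: "AE x in lborel. ereal a < ereal x \<longrightarrow> ereal x < ereal b \<longrightarrow> 0 \<le> f x"
    using f0 by (intro AE_I2) auto
  note ftc = interval_integral_FTC_nonneg[where F = "\<lambda>x. arcsin (g x)" and f = f, OF lt _ _ nn limA limB]
  show "set_integrable lborel {a<..<b} f"
    using ftc(1) der cf by simp
  show "(LBINT x=a..b. f x) = pi"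
    using ftc(2) der cf by simp
qed

text \<open>Here \<open>g\<close> is the increasing affine map of \<open>[a, b]\<close> onto
  \<open>[-1, 1]\<close>. This integral later supplies the first moment of the reciprocal
  density.\<close>

lemma arcsine_density:
  fixes a b :: real
  assumes ab: "a < b"
  shows "set_integrable lborel {a<..<b} (\<lambda>p. 1 / sqrt ((p - a) * (b - p)))"
    and "(LBINT p=a..b. 1 / sqrt ((p - a) * (b - p))) = pi"
proof -
  define g where "g x = (2 * x - a - b) / (b - a)" for x
  define h where "h x = 2 * sqrt ((x - a) * (b - x)) / (b - a)" for x
  have q: "(x - a) * (b - x) > 0" if "a < x" "x < b" for x
    using that by simp
  have sq: "1 - (g x)\<^sup>2 = (h x)\<^sup>2" if "a < x" "x < b" for x
  proof -
    have "(h x)\<^sup>2 = 4 * ((x - a) * (b - x)) / (b - a)\<^sup>2"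
      using q[OF that] by (simp add: h_def power_divide power_mult_distrib)
    also have "\<dots> = 1 - (g x)\<^sup>2"
      using ab by (simp add: g_def power_divide divide_simps) (simp add: power2_eq_square algebra_simps)
    finally show ?thesis ..
  qed
  have g: "(g has_real_derivative 2 / (b - a)) (at x)" for x
    unfolding g_def using ab by (auto intro!: derivative_eq_intros simp: divide_simps)
  have cg: "continuous_on {a..b} g"
    unfolding g_def using ab by (intro continuous_intros) auto
  have cf: "isCont (\<lambda>p. 1 / sqrt ((p - a) * (b - p))) x" if "a < x" "x < b" for x
    using q[OF that] by (intro continuous_intros) auto
  show "set_integrable lborel {a<..<b} (\<lambda>p. 1 / sqrt ((p - a) * (b - p)))"
    by (rule arcsin_FTC(1)[OF ab g sq _ _ _ cf cg])
      (use ab q in \<open>auto simp: g_def h_def divide_simps\<close>)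
  show "(LBINT p=a..b. 1 / sqrt ((p - a) * (b - p))) = pi"
    by (rule arcsin_FTC(2)[OF ab g sq _ _ _ cf cg])
      (use ab q in \<open>auto simp: g_def h_def divide_simps\<close>)
qed

text \<open>The inversion \<open>u = 1 / p\<close> carries this density to the arcsine density on
  \<open>(1/b, 1/a)\<close>. Accordingly \<open>g\<close> is the increasing map of
  \<open>[a, b]\<close> onto \<open>[-1, 1]\<close> that is affine in \<open>1 / x\<close>.\<close>

lemma reciprocal_arcsine_density:
  fixes a b :: real
  assumes a: "0 < a" and ab: "a < b"
  shows "set_integrable lborel {a<..<b} (\<lambda>p. sqrt (a * b) / (p * sqrt ((p - a) * (b - p))))"
    and "(LBINT p=a..b. sqrt (a * b) / (p * sqrt ((p - a) * (b - p)))) = pi"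
proof -
  define f where "f p = sqrt (a * b) / (p * sqrt ((p - a) * (b - p)))" for p
  define g where "g x = (a + b - 2 * a * b / x) / (b - a)" for x
  define h where "h x = 2 * sqrt (a * b) * sqrt ((x - a) * (b - x)) / (x * (b - a))" for x
  have b: "0 < b"
    using a ab by simp
  have q: "(x - a) * (b - x) > 0" if "a < x" "x < b" for x
    using that by simp
  have sq: "1 - (g x)\<^sup>2 = (h x)\<^sup>2" if "a < x" "x < b" for x
  proof -
    have x: "x > 0" "b - a \<noteq> 0"
      using that a by auto
    have "(h x)\<^sup>2 = 4 * (a * b) * ((x - a) * (b - x)) / (x * (b - a))\<^sup>2"
      using q[OF that] a b by (simp add: h_def power_divide power_mult_distrib)
    \<comment> \<open>A difference of squares with factors \<open>2 * a * (b - x)\<close> and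
      \<open>2 * b * (x - a)\<close>.\<close>
    also have "\<dots> = ((x * (b - a))\<^sup>2 - ((a + b) * x - 2 * a * b)\<^sup>2) / (x * (b - a))\<^sup>2"
      by (simp add: power2_eq_square algebra_simps)
    also have "\<dots> = 1 - (((a + b) * x - 2 * a * b) / (x * (b - a)))\<^sup>2"
      using x by (subst diff_divide_distrib) (simp only: power_divide, simp)
    also have "((a + b) * x - 2 * a * b) / (x * (b - a)) = g x"
      using x by (simp add: g_def field_simps)
    finally show ?thesis ..
  qed
  have g: "(g has_real_derivative 2 * a * b / x\<^sup>2 / (b - a)) (at x)" if "a < x" "x < b" for x
    unfolding g_def using ab a that
    by (auto intro!: derivative_eq_intros simp: power2_eq_square)
  have cg: "continuous_on {a..b} g"
    unfolding g_def using ab a by (intro continuous_intros) auto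
  have cf: "isCont f x" if "a < x" "x < b" for x
    unfolding f_def using q[OF that] that a by (intro continuous_intros) auto
  have f: "f x = 2 * a * b / x\<^sup>2 / (b - a) / h x" if "a < x" "x < b" for x
  proof -
    \<comment> \<open>One factor \<open>sqrt (a * b)\<close> must cancel against \<open>h x\<close>;
      \<open>real_sqrt_mult_self\<close> is removed below so that the simplifier does not merge the
      two again.\<close>
    have "2 * a * b = 2 * (sqrt (a * b) * sqrt (a * b))"
      using a b by simp
    then show ?thesis
      using that a b q[OF that] unfolding f_def h_def
      by (simp add: divide_simps power2_eq_square del: real_sqrt_mult_self)
  qed
  have h: "h x > 0" if "a < x" "x < b" for x
    unfolding h_def using that a b q[OF that] by simp
  have f0: "f x \<ge> 0" if "a < x" "x < b" for x
    unfolding f_def using that a b by simp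
  have gab: "g a = -1" "g b = 1"
    using a b ab by (simp_all add: g_def divide_simps)
  note ftc = arcsin_FTC[OF ab g sq h f f0 cf cg gab]
  show "set_integrable lborel {a<..<b} (\<lambda>p. sqrt (a * b) / (p * sqrt ((p - a) * (b - p))))"
    using ftc(1) unfolding f_def .
  show "(LBINT p=a..b. sqrt (a * b) / (p * sqrt ((p - a) * (b - p)))) = pi"
    using ftc(2) unfolding f_def .
qed

section \<open>Bounds for the weighted integral\<close>

text \<open>The factor \<open>sqrt (y / (p + y))\<close> decreases in \<open>p\<close>, so its
  end-point values times the mass \<open>pi\<close> of \<open>W\<close> bound \<open>I\<close>; this
  is sharp when \<open>a\<close> and \<open>b\<close> coalesce. For large \<open>lam\<close> the
  quotient \<open>b / y\<close> tends to 1 and the first bound is too weak, whereas the third sees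
  only the first moment of \<open>W\<close>.\<close>

lemma weighted_integral_bounds:
  fixes a b y :: real
  defines "W \<equiv> \<lambda>p. sqrt (a * b) / (p * sqrt ((p - a) * (b - p)))"
  defines "I \<equiv> (LBINT p=a..b. sqrt (y / (p + y)) * W p)"
  assumes a: "0 < a" and ab: "a < b" and y: "0 < y"
  shows "sqrt (y / (b + y)) * pi \<le> I"
    and "I \<le> sqrt (y / (a + y)) * pi"
    and "pi - pi * sqrt (a * b) / (2 * y) \<le> I"
proof -
  define V where "V = (\<lambda>p. 1 / sqrt ((p - a) * (b - p)))"
  let ?S = "{a<..<b}"
  have V: "set_integrable lborel ?S V" "(LINT p:?S|lborel. V p) = pi"
    using arcsine_density[OF ab] ab by (simp_all add: V_def interval_lebesgue_integral_def)
  have W: "set_integrable lborel ?S W" "(LINT p:?S|lborel. W p) = pi"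
    using reciprocal_arcsine_density[OF a ab] ab
    by (simp_all add: W_def interval_lebesgue_integral_def)
  have I: "I = (LINT p:?S|lborel. sqrt (y / (p + y)) * W p)"
    using ab by (simp add: I_def interval_lebesgue_integral_def)
  have W0: "W p \<ge> 0" if "p \<in> ?S" for p
    using that a by (simp add: W_def)
  have le1: "sqrt (y / (p + y)) \<le> 1" "sqrt (y / (p + y)) \<ge> 0" if "p \<in> ?S" for p
    using that a y by (auto simp: divide_simps)
  have X: "set_integrable lborel ?S (\<lambda>p. sqrt (y / (p + y)) * W p)"
  proof (rule set_integrable_bound[OF W(1)])
    show "set_borel_measurable lborel ?S (\<lambda>p. sqrt (y / (p + y)) * W p)"
      unfolding set_borel_measurable_def W_def by measurable
    have "norm (sqrt (y / (p + y)) * W p) \<le> norm (W p)" if "p \<in> ?S" for p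
      using mult_right_mono[OF le1(1)[OF that] W0[OF that]] le1(2)[OF that] W0[OF that]
      by (simp add: abs_mult)
    then show "AE p in lborel. p \<in> ?S \<longrightarrow> norm (sqrt (y / (p + y)) * W p) \<le> norm (W p)"
      by (intro AE_I2) blast
  qed
  have "(LINT p:?S|lborel. sqrt (y / (b + y)) * W p) \<le> I"
    unfolding I
    by (intro set_integral_mono X set_integrable_mult_right W(1) mult_right_mono W0)
      (use a y in \<open>auto intro!: divide_left_mono\<close>)
  then show "sqrt (y / (b + y)) * pi \<le> I"
    by (simp add: W(2))
  have "I \<le> (LINT p:?S|lborel. sqrt (y / (a + y)) * W p)"
    unfolding I
    by (intro set_integral_mono X set_integrable_mult_right W(1) mult_right_mono W0)
      (use a y in \<open>auto intro!: divide_left_mono\<close>)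
  then show "I \<le> sqrt (y / (a + y)) * pi"
    by (simp add: W(2))
  have lin: "W p - sqrt (a * b) / (2 * y) * V p \<le> sqrt (y / (p + y)) * W p" if p: "p \<in> ?S" for p
  proof -
    \<comment> \<open>The left side is the tangent at \<open>p = 0\<close> of the convex right side.
      The inequality is checked by squaring while the left side is nonnegative, and is trivial
      afterwards.\<close>
    have "(1 - p / (2 * y)) \<le> sqrt (y / (p + y))"
    proof (cases "p / (2 * y) \<le> 1")
      case True
      define t where "t = p / (2 * y)"
      have t: "0 \<le> t" "t \<le> 1" "p = 2 * y * t"
        using True p a y by (auto simp: t_def)
      have "p + y = y * (1 + 2 * t)"
        by (simp add: t(3) algebra_simps)
      then have eq: "y / (p + y) = 1 / (1 + 2 * t)"
        using y by simp
      have "(1 - t)\<^sup>2 * (1 + 2 * t) = 1 - t\<^sup>2 * (3 - 2 * t)"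
        by (simp add: power2_eq_square algebra_simps)
      also have "\<dots> \<le> 1"
        using t by simp
      finally have "(1 - t)\<^sup>2 \<le> y / (p + y)"
        unfolding eq using t by (simp add: field_simps)
      then show ?thesis
        unfolding t_def by (rule real_le_rsqrt)
    next
      case False
      then show ?thesis
        using le1(2)[OF p] by linarith
    qed
    then have "(1 - p / (2 * y)) * W p \<le> sqrt (y / (p + y)) * W p"
      by (rule mult_right_mono[OF _ W0[OF p]])
    \<comment> \<open>The factor \<open>p\<close> cancels the one in the denominator of
      \<open>W\<close>, leaving \<open>sqrt (a * b) * V p\<close>.\<close>
    also have "(1 - p / (2 * y)) * W p = W p - sqrt (a * b) / (2 * y) * V p"
    proof -
      define q where "q = sqrt ((p - a) * (b - p))"
      have "q > 0" "p > 0"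
        using p a by (auto simp: q_def)
      then show ?thesis
        unfolding W_def V_def q_def[symmetric] using y by (simp add: field_simps)
    qed
    finally show ?thesis .
  qed
  have "(LINT p:?S|lborel. W p - sqrt (a * b) / (2 * y) * V p) \<le> I"
    unfolding I
    by (intro set_integral_mono X set_integral_diff(1) set_integrable_mult_right W(1) V(1) lin)
  also have "(LINT p:?S|lborel. W p - sqrt (a * b) / (2 * y) * V p) = pi - sqrt (a * b) / (2 * y) * pi"
    using V W by (subst set_integral_diff(2)) auto
  finally show "pi - pi * sqrt (a * b) / (2 * y) \<le> I"
    by (simp add: mult.commute)
qed

section \<open>Vieta relations and bounds in terms of the largest root\<close>

text \<open>From \<open>a + b = y\<close> and \<open>a * b = \<mu> / y\<close>, the numbers
  \<open>a\<close> and \<open>b\<close> solve a quadratic equation with root difference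
  \<open>d\<close>, so they equal \<open>(y - d) / 2\<close> and \<open>(y + d) / 2\<close>. All
  bounds thus depend on \<open>y\<close> alone, and its size is controlled by
  \<open>y^2 - lam = a * b\<close> and \<open>4 * lam - 3 * y^2 = (b - a)^2\<close>.\<close>

lemma Lambda_Theta_bounds:
  fixes \<mu> lam :: real
  defines "y \<equiv> cubic_root \<mu> lam 3"
  defines "d \<equiv> sqrt (y\<^sup>2 - 4 * \<mu> / y)"
  assumes \<mu>: "\<mu> > 0" and lam: "lam > lambda_crit \<mu>"
  shows "y > 0" "4 * \<mu> < y ^ 3" "lam \<le> y\<^sup>2" "3 * y\<^sup>2 \<le> 4 * lam"
    and "2 * pi * sqrt (y / ((y + d) / 2 + y)) \<le> Lambda_Theta \<mu> lam"
    and "Lambda_Theta \<mu> lam \<le> 2 * pi * sqrt (y / ((y - d) / 2 + y))"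
    and "2 * pi - pi * sqrt (\<mu> / y ^ 3) \<le> Lambda_Theta \<mu> lam"
    and "Lambda_Theta \<mu> lam \<le> 2 * pi"
proof -
  define a where "a = - cubic_root \<mu> lam 2"
  define b where "b = - cubic_root \<mu> lam 1"
  note R = cubic_three_roots[OF \<mu> lam]
  have a: "0 < a" and ab: "a < b" and y: "0 < y"
    using R(2-4) by (simp_all add: a_def b_def y_def)
  have b: "0 < b"
    using a ab by simp
  have "cubic \<mu> lam (-a) = 0" "cubic \<mu> lam (-b) = 0" "cubic \<mu> lam y = 0"
    using R(1) by (auto simp: a_def b_def y_def)
  then have roots: "\<mu> = lam * a - a ^ 3" "\<mu> = lam * b - b ^ 3" "\<mu> = y ^ 3 - lam * y"
    by (simp_all add: cubic_def)
  \<comment> \<open>Vieta's relations follow by subtracting root equations in pairs and cancelling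
    the nonzero differences of the roots \<open>-a\<close>, \<open>-b\<close>,
    \<open>y\<close>.\<close>
  have "(b - a) * (lam - (a\<^sup>2 + a * b + b\<^sup>2)) = 0"
    using roots(1,2) by (simp add: algebra_simps power2_eq_square power3_eq_cube)
  then have lam_ab: "lam = a\<^sup>2 + a * b + b\<^sup>2"
    using ab by simp
  have "(a + y) * (lam - (a\<^sup>2 - a * y + y\<^sup>2)) = 0"
    using roots(1,3) by (simp add: algebra_simps power2_eq_square power3_eq_cube)
  then have "lam = a\<^sup>2 - a * y + y\<^sup>2"
    using a y by simp
  with lam_ab have "(y + b) * (y - a - b) = 0"
    by (simp add: algebra_simps power2_eq_square)
  then have y_ab: "y = a + b"
    using y b by simp
  have \<mu>_ab: "\<mu> = a * b * y"
    unfolding roots(1) lam_ab y_ab by (simp add: algebra_simps power2_eq_square power3_eq_cube)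
  show "y > 0" by (fact y)
  show "lam \<le> y\<^sup>2"
    unfolding y_ab lam_ab using a b by (simp add: power2_eq_square algebra_simps)
  show "3 * y\<^sup>2 \<le> 4 * lam"
    unfolding y_ab lam_ab using zero_le_power2[of "a - b"] by (simp add: power2_eq_square algebra_simps)
  have "0 < (b - a)\<^sup>2 * y"
    using ab y by simp
  also have "\<dots> = y ^ 3 - 4 * \<mu>"
    unfolding \<mu>_ab y_ab by (simp add: algebra_simps power2_eq_square power3_eq_cube)
  finally show "4 * \<mu> < y ^ 3"
    by simp
  have "4 * \<mu> / y = 4 * a * b"
    using y by (simp add: \<mu>_ab)
  then have "y\<^sup>2 - 4 * \<mu> / y = (b - a)\<^sup>2"
    by (simp add: y_ab algebra_simps power2_eq_square)
  then have d: "d = b - a"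
    using ab by (simp add: d_def)
  have bd: "(y + d) / 2 = b" "(y - d) / 2 = a"
    by (simp_all add: d y_ab)
  have fac: "cubic \<mu> lam (-p) = (p - a) * (b - p) * (p + y)" for p
    unfolding cubic_def \<mu>_ab lam_ab y_ab by (simp add: algebra_simps power2_eq_square power3_eq_cube)
  have sqrt_\<mu>: "sqrt \<mu> = sqrt a * sqrt b * sqrt y"
    by (simp add: \<mu>_ab real_sqrt_mult)
  define I where "I = (LBINT p=a..b. sqrt (y / (p + y)) * (sqrt (a * b) / (p * sqrt ((p - a) * (b - p)))))"
  have "Lambda_Theta \<mu> lam = - 2 * sqrt \<mu> *
      (LBINT p=ereal a..ereal b. 1 / (- p * sqrt (cubic \<mu> lam (-p))))"
    unfolding Lambda_Theta_def by (subst interval_integral_reflect) (simp add: a_def b_def)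
  \<comment> \<open>The sign of \<open>- p\<close> cancels the one in front. Of
    \<open>sqrt \<mu>\<close>, the part \<open>sqrt y\<close> pairs with
    \<open>sqrt (p + y)\<close>, and \<open>sqrt (a * b)\<close> normalizes the density.\<close>
  also have "\<dots> = (LBINT p=ereal a..ereal b. 2 * (sqrt (y / (p + y)) *
      (sqrt (a * b) / (p * sqrt ((p - a) * (b - p))))))"
    unfolding interval_lebesgue_integral_mult_right[symmetric] fac sqrt_\<mu>
    by (intro interval_integral_cong) (simp add: real_sqrt_mult real_sqrt_divide mult_ac)
  also have "\<dots> = 2 * I"
    unfolding I_def by (rule interval_lebesgue_integral_mult_right)
  finally have L: "Lambda_Theta \<mu> lam = 2 * I" .
  note B = weighted_integral_bounds[OF a ab y, folded I_def]
  show "2 * pi * sqrt (y / ((y + d) / 2 + y)) \<le> Lambda_Theta \<mu> lam"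
    using B(1) by (simp add: L bd mult.commute)
  show up: "Lambda_Theta \<mu> lam \<le> 2 * pi * sqrt (y / ((y - d) / 2 + y))"
    using B(2) by (simp add: L bd mult.commute)
  have "2 * pi * sqrt (y / (a + y)) \<le> 2 * pi * 1"
    using a y by (intro mult_left_mono) auto
  then show "Lambda_Theta \<mu> lam \<le> 2 * pi"
    using up unfolding bd by linarith
  have "\<mu> / y ^ 3 = a * b / y\<^sup>2"
    using y by (simp add: \<mu>_ab power2_eq_square power3_eq_cube)
  then have "sqrt (\<mu> / y ^ 3) = sqrt (a * b) / y"
    using y by (simp add: real_sqrt_divide)
  then show "2 * pi - pi * sqrt (\<mu> / y ^ 3) \<le> Lambda_Theta \<mu> lam"
    using B(3) by (simp add: L field_simps)
qed

section \<open>The two limits\<close>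

text \<open>At the critical value the cubic is \<open>(x + m)^2 * (x - 2 * m)\<close>. The bounds
  \<open>4 * \<mu> < y^3\<close> and \<open>3 * y^2 \<le> 4 * lam\<close> squeeze \<open>y\<close>
  between \<open>2 * m\<close> and \<open>sqrt (4 * lam / 3)\<close>, which meet there.\<close>

lemma largest_root_tendsto_crit:
  assumes "\<mu> > 0"
  shows "((\<lambda>lam. cubic_root \<mu> lam 3) \<longlongrightarrow> 2 * (\<mu> / 2) powr (1/3)) (at_right (lambda_crit \<mu>))"
proof -
  define m where "m = (\<mu> / 2) powr (1/3)"
  have m: "m > 0" "m ^ 3 = \<mu> / 2" "lambda_crit \<mu> = 3 * m\<^sup>2"
    using assms(1) by (simp_all add: m_def lambda_crit_def powr_power)
  have ev: "\<forall>\<^sub>F lam in at_right (lambda_crit \<mu>). lam > lambda_crit \<mu>"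
    by (simp add: eventually_at_right_less)
  have "((\<lambda>lam. sqrt (4 * lam / 3)) \<longlongrightarrow> sqrt (4 * lambda_crit \<mu> / 3)) (at_right (lambda_crit \<mu>))"
    by (intro tendsto_intros) simp
  moreover have "sqrt (4 * lambda_crit \<mu> / 3) = 2 * m"
    using m(1) by (simp add: m(3) real_sqrt_mult)
  ultimately have lim: "((\<lambda>lam. sqrt (4 * lam / 3)) \<longlongrightarrow> 2 * m) (at_right (lambda_crit \<mu>))"
    by simp
  have "\<forall>\<^sub>F lam in at_right (lambda_crit \<mu>). 2 * m \<le> cubic_root \<mu> lam 3"
    using ev
  proof eventually_elim
    case (elim lam)
    note B = Lambda_Theta_bounds[OF assms elim]
    have "(2 * m) ^ 3 = 4 * \<mu>"
      using m by (simp add: power_mult_distrib)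
    with B(2) have "(2 * m) ^ 3 \<le> (cubic_root \<mu> lam 3) ^ 3"
      by linarith
    then show ?case
      using B(1) m(1) power_mono_iff[of "2 * m" "cubic_root \<mu> lam 3" 3] by linarith
  qed
  moreover have "\<forall>\<^sub>F lam in at_right (lambda_crit \<mu>). cubic_root \<mu> lam 3 \<le> sqrt (4 * lam / 3)"
    using ev
  proof eventually_elim
    case (elim lam)
    show ?case
      using Lambda_Theta_bounds(4)[OF assms elim] by (intro real_le_rsqrt) simp
  qed
  ultimately show ?thesis
    unfolding m_def[symmetric] by (rule tendsto_sandwich[OF _ _ tendsto_const lim])
qed

theorem proposition4p8:
  fixes \<mu> :: real
  assumes "\<mu> > 0"
  shows "(Lambda_Theta \<mu> \<longlongrightarrow> 2 * sqrt (2/3) * pi) (at_right (lambda_crit \<mu>))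
       \<and> (Lambda_Theta \<mu> \<longlongrightarrow> 2 * pi) at_top"
proof
  let ?y = "\<lambda>lam. cubic_root \<mu> lam 3"
  define m where "m = (\<mu> / 2) powr (1/3)"
  have m: "m > 0" "\<mu> = 2 * m ^ 3"
    using assms(1) by (simp_all add: m_def powr_power)
  have ev: "\<forall>\<^sub>F lam in at_right (lambda_crit \<mu>). lam > lambda_crit \<mu>"
    by (simp add: eventually_at_right_less)
  have y: "(?y \<longlongrightarrow> 2 * m) (at_right (lambda_crit \<mu>))"
    unfolding m_def by (rule largest_root_tendsto_crit[OF assms])
  \<comment> \<open>The expression under the root in \<open>d\<close> vanishes at
    \<open>y = 2 * m\<close>: the two negative roots merge.\<close>
  have z: "4 * \<mu> / (2 * m) = (2 * m)\<^sup>2"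
    using m by (simp add: power2_eq_square power3_eq_cube)
  have d: "((\<lambda>lam. sqrt ((?y lam)\<^sup>2 - 4 * \<mu> / ?y lam)) \<longlongrightarrow> 0) (at_right (lambda_crit \<mu>))"
  proof -
    have "((\<lambda>lam. sqrt ((?y lam)\<^sup>2 - 4 * \<mu> / ?y lam)) \<longlongrightarrow> sqrt ((2 * m)\<^sup>2 - 4 * \<mu> / (2 * m)))
        (at_right (lambda_crit \<mu>))"
      using m(1) by (intro tendsto_intros y) simp
    then show ?thesis
      by (simp only: z) simp
  qed
  have v: "2 * pi * sqrt (2 * m / ((2 * m + 0) / 2 + 2 * m)) = 2 * sqrt (2/3) * pi"
    "2 * pi * sqrt (2 * m / ((2 * m - 0) / 2 + 2 * m)) = 2 * sqrt (2/3) * pi"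
  proof -
    \<comment> \<open>With \<open>d = 0\<close> both end-point bounds have the same limit, the
      factor at \<open>p = m\<close>, \<open>y = 2 * m\<close>.\<close>
    have "2 * m / (m + 2 * m) = 2 / 3"
      using m(1) by (simp add: field_simps)
    then show "2 * pi * sqrt (2 * m / ((2 * m + 0) / 2 + 2 * m)) = 2 * sqrt (2/3) * pi"
      "2 * pi * sqrt (2 * m / ((2 * m - 0) / 2 + 2 * m)) = 2 * sqrt (2/3) * pi"
      by simp_all
  qed
  show "(Lambda_Theta \<mu> \<longlongrightarrow> 2 * sqrt (2/3) * pi) (at_right (lambda_crit \<mu>))"
  proof (rule tendsto_sandwich)
    show "((\<lambda>lam. 2 * pi * sqrt (?y lam / ((?y lam + sqrt ((?y lam)\<^sup>2 - 4 * \<mu> / ?y lam)) / 2 + ?y lam)))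
        \<longlongrightarrow> 2 * sqrt (2/3) * pi) (at_right (lambda_crit \<mu>))"
      unfolding v(1)[symmetric] using m(1) by (intro tendsto_intros y d) auto
    show "((\<lambda>lam. 2 * pi * sqrt (?y lam / ((?y lam - sqrt ((?y lam)\<^sup>2 - 4 * \<mu> / ?y lam)) / 2 + ?y lam)))
        \<longlongrightarrow> 2 * sqrt (2/3) * pi) (at_right (lambda_crit \<mu>))"
      unfolding v(2)[symmetric] using m(1) by (intro tendsto_intros y d) auto
  qed (use ev Lambda_Theta_bounds[OF assms] in \<open>auto elim!: eventually_mono\<close>)
next
  let ?y = "\<lambda>lam. cubic_root \<mu> lam 3"
  have ev: "\<forall>\<^sub>F lam in at_top. lam > max (lambda_crit \<mu>) 0"
    by (rule eventually_gt_at_top)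
  have lim: "filterlim ?y at_top at_top"
  proof (rule filterlim_at_top_mono[OF sqrt_at_top])
    show "\<forall>\<^sub>F lam in at_top. sqrt lam \<le> ?y lam"
      using ev
    proof eventually_elim
      case (elim lam)
      then show ?case
        using Lambda_Theta_bounds(1,3)[OF assms, of lam] by (intro real_le_lsqrt) auto
    qed
  qed
  \<comment> \<open>The defect in the lower bound vanishes as \<open>y\<close> grows; the upper
    bound is the constant \<open>2 * pi\<close>.\<close>
  have "((\<lambda>lam. \<mu> / ?y lam ^ 3) \<longlongrightarrow> 0) at_top"
    by (intro real_tendsto_divide_at_top[OF tendsto_const] filterlim_pow_at_top lim) simp
  then have "((\<lambda>lam. 2 * pi - pi * sqrt (\<mu> / ?y lam ^ 3)) \<longlongrightarrow> 2 * pi - pi * sqrt 0) at_top"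
    by (intro tendsto_intros)
  then have low: "((\<lambda>lam. 2 * pi - pi * sqrt (\<mu> / ?y lam ^ 3)) \<longlongrightarrow> 2 * pi) at_top"
    by simp
  show "(Lambda_Theta \<mu> \<longlongrightarrow> 2 * pi) at_top"
    by (rule tendsto_sandwich[OF _ _ low tendsto_const])
      (use ev Lambda_Theta_bounds[OF assms] in \<open>auto elim!: eventually_mono\<close>)
qed

end
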